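(* Let $\lambda>0$ and let $r$ be a minimizer over $\mathcal{A}_\lambda$ of $$I(r)=\int_0^1\left[\tilde\Phi\left(r'(R),\frac{r(R)}{R},\frac{r(R)}{R}\right)-\rho_0(R)\frac{M_R}{r(R)}\right]R^2\,dR.$$ If $\lambda<\lambda_c^h$, then $r(0)=0$.
   Context: $\tilde\Phi:(0,\infty)^3\to[0,\infty)$ is a symmetric (homogeneous, isotropic) stored energy function. The reference mass density $\rho_0:[0,1]\to\mathbb{R}$ satisfies $k_0\le\rho_0(R)\le k_1$ for $0\le R\le 1$, with positive constants $k_0,k_1$, and $M_R=4\pi\int_0^R\rho_0(u)u^2\,du$. Put $I_{\rm mec}(r)=\int_0^1\tilde\Phi\left(r'(R),\frac{r(R)}{R},\frac{r(R)}{R}\right)R^2\,dR$ and, for $\lambda>0$, $$\mathcal{A}_\lambda=\{r\in W^{1,1}(0,1): r(1)=\lambda,\ r'(R)>0\text{ for a.e. }R\in(0,1),\ r(0)\ge0,\ I_{\rm mec}(r)<\infty\}.$$ Standing assumption: $\tilde\Phi(v_1,v_2,v_3)\ge\phi(v_1)+\phi(v_2)+\phi(v_3)+h(v_1v_2v_3)$, where $\phi,h:(0,\infty)\to(0,\infty)$ are strictly convex, $\phi(v)\ge Cv^\gamma$ for some $C>0$ and $1<\gamma<3$; $h(d)/d\to\infty$ as $d\to\infty$; and $h(d)\ge Kd^{-s}$ for all $d>0$, for some $K>0$ and $s\ge\gamma^*=\frac{\gamma}{\gamma-1}$. $\lambda_c^h$ denotes the critical boundary displacement of the (Ball) radial cavitation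 problem without gravity for $\tilde\Phi$, i.e. the number such that: for $0<\lambda\le\lambda_c^h$ the homogeneous map $R\mapsto\lambda R$ is the unique minimizer of $I_{\rm mec}$ over $\mathcal{A}_\lambda$, while for $\lambda>\lambda_c^h$ every minimizer $r$ of $I_{\rm mec}$ over $\mathcal{A}_\lambda$ satisfies $r(0)>0$. *)

theory Defs
  imports "HOL-Analysis.Analysis"
begin

section \<open>The Sobolev space of the unit interval\<close>

text \<open>
  Weak derivatives on \<open>(0,1)\<close> are taken against compactly supported test functions of
  class \<open>C\<^sup>1\<close>.  Test functions are total, and vanish outside \<open>(0,1)\<close>.
\<close>

definition test_function :: "(real \<Rightarrow> real) \<Rightarrow> bool" where
  "test_function \<psi> \<longleftrightarrow>
     \<psi> C1_differentiable_on UNIV \<and>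
     compact (closure {x. \<psi> x \<noteq> 0}) \<and> closure {x. \<psi> x \<noteq> 0} \<subseteq> {0<..<1}"

definition has_weak_derivative :: "(real \<Rightarrow> real) \<Rightarrow> (real \<Rightarrow> real) \<Rightarrow> bool" where
  "has_weak_derivative r g \<longleftrightarrow>
     set_integrable lebesgue {0<..<1} g \<and>
     (\<forall>\<psi>. test_function \<psi> \<longrightarrow>
        (LINT x:{0<..<1}|lebesgue. r x * deriv \<psi> x) =
          - (LINT x:{0<..<1}|lebesgue. g x * \<psi> x))"

definition W11 :: "(real \<Rightarrow> real) set" where
  "W11 = {r. set_integrable lebesgue {0<..<1} r \<and> (\<exists>g. has_weak_derivative r g)}"

text \<open>
  The weak derivative is determined only up to a null set of \<open>(0,1)\<close>; nothing below
  depends on the choice.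
\<close>

definition weak_deriv :: "(real \<Rightarrow> real) \<Rightarrow> real \<Rightarrow> real" where
  "weak_deriv r = (SOME g. has_weak_derivative r g)"


section \<open>Energies and admissible maps\<close>

definition strictly_convex_on :: "real set \<Rightarrow> (real \<Rightarrow> real) \<Rightarrow> bool" where
  "strictly_convex_on S f \<longleftrightarrow> convex S \<and>
     (\<forall>x\<in>S. \<forall>y\<in>S. \<forall>t\<in>{0<..<1}. x \<noteq> y \<longrightarrow>
        f ((1 - t) * x + t * y) < (1 - t) * f x + t * f y)"

definition mec_density ::
    "(real \<Rightarrow> real \<Rightarrow> real \<Rightarrow> real) \<Rightarrow> (real \<Rightarrow> real) \<Rightarrow> real \<Rightarrow> real" where
  "mec_density \<Phi> r R = \<Phi> (weak_deriv r R) (r R / R) (r R / R)"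

definition I_mec :: "(real \<Rightarrow> real \<Rightarrow> real \<Rightarrow> real) \<Rightarrow> (real \<Rightarrow> real) \<Rightarrow> real" where
  "I_mec \<Phi> r = (LINT R:{0<..<1}|lebesgue. mec_density \<Phi> r R * R\<^sup>2)"

text \<open>
  An element of \<open>W\<^sup>1\<^sup>,\<^sup>1(0,1)\<close> is represented by its continuous representative on \<open>[0,1]\<close>,
  which gives the boundary values \<open>r(0)\<close> and \<open>r(1)\<close> their meaning; values outside \<open>[0,1]\<close>
  are irrelevant.  As the stored energy is nonnegative, \<open>I\<^sub>m\<^sub>e\<^sub>c(r) < \<infinity>\<close> is integrability of the
  integrand (the Bochner integral of a non-integrable function would be \<open>0\<close>).
\<close>

definition admissible ::
    "(real \<Rightarrow> real \<Rightarrow> real \<Rightarrow> real) \<Rightarrow> real \<Rightarrow> (real \<Rightarrow> real) set" where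
  "admissible \<Phi> lam = {r. r \<in> W11 \<and> continuous_on {0..1} r \<and>
     r 1 = lam \<and>
     (AE R \<in> {0<..<1} in lebesgue. weak_deriv r R > 0) \<and>
     r 0 \<ge> 0 \<and>
     set_integrable lebesgue {0<..<1} (\<lambda>R. mec_density \<Phi> r R * R\<^sup>2)}"

definition mass_within :: "(real \<Rightarrow> real) \<Rightarrow> real \<Rightarrow> real" where
  "mass_within \<rho> R = 4 * pi * (LINT u:{0..R}|lebesgue. \<rho> u * u\<^sup>2)"

text \<open>
  Under the growth condition \<open>h(d) \<ge> K d\<^sup>-\<^sup>s\<close> with \<open>s > 1\<close>, admissible maps satisfy
  \<open>r(R) \<ge> c R\<^bsup>(s+1)/s\<^esup>\<close> with \<open>c > 0\<close>, so the gravitational term is integrable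
  and the integral below is a genuine one for every admissible map.
\<close>

definition I_grav ::
    "(real \<Rightarrow> real \<Rightarrow> real \<Rightarrow> real) \<Rightarrow> (real \<Rightarrow> real) \<Rightarrow> (real \<Rightarrow> real) \<Rightarrow> real" where
  "I_grav \<Phi> \<rho> r =
     (LINT R:{0<..<1}|lebesgue. (mec_density \<Phi> r R - \<rho> R * (mass_within \<rho> R / r R)) * R\<^sup>2)"

definition minimizer ::
    "((real \<Rightarrow> real) \<Rightarrow> real) \<Rightarrow> (real \<Rightarrow> real) set \<Rightarrow> (real \<Rightarrow> real) \<Rightarrow> bool" where
  "minimizer J A r \<longleftrightarrow> is_arg_min J (\<lambda>q. q \<in> A) r"

definition critical_displacement ::
    "(real \<Rightarrow> real \<Rightarrow> real \<Rightarrow> real) \<Rightarrow> real \<Rightarrow> bool" where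
  "critical_displacement \<Phi> lamc \<longleftrightarrow> lamc > 0 \<and>
     (\<forall>lam. 0 < lam \<and> lam \<le> lamc \<longrightarrow>
        minimizer (I_mec \<Phi>) (admissible \<Phi> lam) (\<lambda>R. lam * R) \<and>
        (\<forall>q. minimizer (I_mec \<Phi>) (admissible \<Phi> lam) q \<longrightarrow> (\<forall>R\<in>{0..1}. q R = lam * R))) \<and>
     (\<forall>lam>lamc. \<forall>q. minimizer (I_mec \<Phi>) (admissible \<Phi> lam) q \<longrightarrow> q 0 > 0)"

end

theory Submission
  imports Defs
begin

text \<open>
  Suppose a minimizer \<open>r\<close> has \<open>r(0) > 0\<close>.  As \<open>r(1) = \<lambda> < \<lambda>\<^sub>c\<close>, there is a first \<open>c \<in> (0,1)\<close> with
  \<open>r(c) = \<lambda>\<^sub>c c\<close>, and \<open>r(R) > \<lambda>\<^sub>c R\<close> on \<open>[0,c)\<close>.  Replace \<open>r\<close> by \<open>\<lambda>\<^sub>c R\<close> on \<open>[0,c]\<close>.  The mechanical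
  energy does not increase, because \<open>R \<mapsto> r(cR)/c\<close> is admissible for the displacement \<open>\<lambda>\<^sub>c\<close>, for
  which the homogeneous map is optimal.  The gravitational energy strictly decreases, because \<open>r\<close>
  was strictly larger on \<open>(0,c)\<close>.

  Gluing and rescaling preserve membership in \<open>W\<^sup>1\<^sup>,\<^sup>1(0,1)\<close>, and weak derivatives are unique almost
  everywhere, since a continuous \<open>r\<close> has the weak derivative \<open>g\<close> if and only if
  \<open>r(x) = r(0) + \<integral>\<^sub>0\<^sup>x g\<close>.
\<close>

section \<open>Weak derivatives and primitives\<close>

text \<open>By additivity \<open>f\<close> integrates to zero over every subinterval. In the
  Henstock lemma the terms \<open>integral k f\<close> then drop out, and what remains small is a
  Riemann sum of \<open>\<bar>f x\<bar>\<close>. So the absolute value has integral zero, although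
  only gauge integrability of \<open>f\<close> is given.\<close>

lemma negligible_nonzero_of_vanishing_integrals:
  fixes f :: "real \<Rightarrow> real"
  assumes f: "f integrable_on {a..b}"
    and zero: "\<And>x. x \<in> {a..b} \<Longrightarrow> integral {a..x} f = 0"
  shows "negligible {x \<in> {a..b}. f x \<noteq> 0}"
proof -
  have sub: "integral {u..v} f = 0" if "a \<le> u" "u \<le> v" "v \<le> b" for u v
  proof -
    have "integral {a..u} f + integral {u..v} f = integral {a..v} f"
      using that by (intro Henstock_Kurzweil_Integration.integral_combine)
        (auto intro: integrable_subinterval_real[OF f])
    then show ?thesis using zero[of u] zero[of v] that by simp
  qed
  have "((\<lambda>x. \<bar>f x\<bar>) has_integral 0) (cbox a b)"
    unfolding has_integral
  proof (intro allI impI)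
    fix e :: real assume "e > 0"
    obtain \<gamma> where g: "gauge \<gamma>"
      and H: "\<And>p. \<lbrakk>p tagged_partial_division_of (cbox a b); \<gamma> fine p\<rbrakk> \<Longrightarrow>
             sum (\<lambda>(x,k). norm (measure lborel k *\<^sub>R f x - integral k f)) p < e"
      using Henstock_lemma[of f a b e] f \<open>e > 0\<close> by auto
    show "\<exists>\<gamma>. gauge \<gamma> \<and> (\<forall>\<D>. \<D> tagged_division_of cbox a b \<and> \<gamma> fine \<D> \<longrightarrow>
           norm ((\<Sum>(x, k)\<in>\<D>. measure lborel k *\<^sub>R \<bar>f x\<bar>) - 0) < e)"
    proof (intro exI[of _ \<gamma>] conjI g allI impI)
      fix p assume p: "p tagged_division_of cbox a b \<and> \<gamma> fine p"
      have eq: "measure lborel K *\<^sub>R \<bar>f x\<bar> = norm (measure lborel K *\<^sub>R f x - integral K f)" if xK: "(x, K) \<in> p" for x K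
      proof -
        obtain u v where K: "K = cbox u v" "K \<subseteq> cbox a b" "x \<in> K"
          using p xK by (meson tagged_division_ofD(2,3,4))
        then have "integral K f = 0" using sub[of u v] by auto
        then show ?thesis by (simp add: abs_mult)
      qed
      have "(\<Sum>(x, k)\<in>p. measure lborel k *\<^sub>R \<bar>f x\<bar>) = sum (\<lambda>(x,k). norm (measure lborel k *\<^sub>R f x - integral k f)) p"
        using eq by (intro sum.cong) auto
      moreover have "0 \<le> (\<Sum>(x, k)\<in>p. measure lborel k *\<^sub>R \<bar>f x\<bar>)"
        by (intro sum_nonneg) auto
      ultimately show "norm ((\<Sum>(x, k)\<in>p. measure lborel k *\<^sub>R \<bar>f x\<bar>) - 0) < e"
        using H[of p] p by (auto simp: tagged_division_of_def)
    qed
  qed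
  then have hi: "((\<lambda>x. \<bar>f x\<bar>) has_integral 0) {a..b}" by simp
  \<comment> \<open>For a nonnegative function gauge integrability is already Lebesgue
    integrability, which opens the way to the a.e. criterion for a zero integral.\<close>
  then have ai: "(\<lambda>x. \<bar>f x\<bar>) absolutely_integrable_on {a..b}"
    by (intro nonnegative_absolutely_integrable_1) auto
  then have "integral\<^sup>L lebesgue (\<lambda>x. indicator {a..b} x *\<^sub>R \<bar>f x\<bar>) = 0"
    using set_lebesgue_integral_eq_integral(2)[OF ai] hi
    by (simp add: set_lebesgue_integral_def integral_unique)
  then have "AE x in lebesgue. indicator {a..b} x *\<^sub>R \<bar>f x\<bar> = 0"
    using ai unfolding set_integrable_def
    by (subst (asm) integral_nonneg_eq_0_iff_AE) auto
  then show ?thesis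
    unfolding eventually_ae_filter_negligible
    by (rule exE) (rule negligible_subset, auto simp: indicator_def)
qed


section \<open>Primitives and integration by parts\<close>

text \<open>Absolute continuity on \<open>{0..1}\<close> with density \<open>g\<close>, in
  integrated form. Gluing and rescaling are direct computations with integrals here, whereas the
  pairing with test functions would make them awkward.\<close>

definition primitive :: "(real \<Rightarrow> real) \<Rightarrow> (real \<Rightarrow> real) \<Rightarrow> bool" where
  "primitive r g \<longleftrightarrow> g absolutely_integrable_on {0..1} \<and> (\<forall>x\<in>{0..1}. r x = r 0 + integral {0..x} g)"

lemma primitive_eq: "primitive r g \<Longrightarrow> x \<in> {0..1} \<Longrightarrow> r x = r 0 + integral {0..x} g"
  unfolding primitive_def by blast

lemma primitive_integrable: "primitive r g \<Longrightarrow> g integrable_on {0..1}"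
  unfolding primitive_def using set_lebesgue_integral_eq_integral(1) by blast

lemma primitive_diff:
  assumes "primitive r g" "0 \<le> x" "x \<le> y" "y \<le> 1"
  shows "r y - r x = integral {x..y} g"
proof -
  have gi: "g integrable_on {0..1}"
    by (rule primitive_integrable[OF assms(1)])
  have "integral {0..x} g + integral {x..y} g = integral {0..y} g"
    using assms by (intro Henstock_Kurzweil_Integration.integral_combine)
        (auto intro: integrable_subinterval_real[OF gi])
  moreover have "r x = r 0 + integral {0..x} g" "r y = r 0 + integral {0..y} g"
    by (rule primitive_eq[OF assms(1)], use assms(2-4) in simp)+
  ultimately show ?thesis by linarith
qed

lemma primitive_continuous_on:
  assumes "primitive r g"
  shows "continuous_on {0..1} r"
proof -
  have "g integrable_on {0..1}"
    by (rule primitive_integrable[OF assms])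
  then have "continuous_on {0..1} (\<lambda>x. r 0 + integral {0..x} g)"
    by (intro continuous_intros indefinite_integral_continuous_1)
  then show ?thesis
    by (rule continuous_on_eq) (rule primitive_eq[OF assms, symmetric])
qed

lemma absolutely_integrable_mult_continuous:
  fixes f g :: "real \<Rightarrow> real"
  assumes f: "f absolutely_integrable_on {a..b}" and g: "continuous_on {a..b} g"
  shows "(\<lambda>x. f x * g x) absolutely_integrable_on {a..b}"
proof -
  have "(\<lambda>x. g x * f x) absolutely_integrable_on {a..b}"
    using g by (intro absolutely_integrable_bounded_measurable_product_real[OF _ _ _ f])
      (auto intro!: continuous_imp_measurable_on_sets_lebesgue compact_imp_bounded compact_continuous_image)
  then show ?thesis by (simp add: mult.commute)
qed

text \<open>The defect of the product rule over \<open>[x,y]\<close> is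
  \<open>O(|y - x| \<integral>\<^sub>x\<^sup>y |g|) = o(|y - x|)\<close>, so it has derivative zero everywhere, although \<open>r\<close> need not
  be differentiable.\<close>

lemma primitive_integration_by_parts:
  assumes r: "primitive r g"
    and \<psi>: "\<And>x. x \<in> {0..1} \<Longrightarrow> (\<psi> has_field_derivative D x) (at x within {0..1})"
    and D: "continuous_on {0..1} D"
  shows "integral {0..1} (\<lambda>x. r x * D x) + integral {0..1} (\<lambda>x. g x * \<psi> x) = r 1 * \<psi> 1 - r 0 * \<psi> 0"
proof -
  have ga: "g absolutely_integrable_on {0..1}" using r by (simp add: primitive_def)
  have gi: "g integrable_on {0..1}" "(\<lambda>x. \<bar>g x\<bar>) integrable_on {0..1}"
    using ga by (auto simp: absolutely_integrable_on_def)
  have rc: "continuous_on {0..1} r" by (rule primitive_continuous_on[OF r])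
  have \<psi>c: "continuous_on {0..1} \<psi>"
    using \<psi> DERIV_continuous continuous_on_eq_continuous_within by blast
  \<comment> \<open>\<open>V\<close> dominates the increments of \<open>r\<close>. As
    \<open>g\<close> may be unbounded, continuity of \<open>V\<close> is the source of the smallness
    needed below.\<close>
  define V where "V x = integral {0..x} (\<lambda>x. \<bar>g x\<bar>)" for x
  have Vc: "continuous_on {0..1} V"
    unfolding V_def by (rule indefinite_integral_continuous_1[OF gi(2)])
  have Vd: "integral {x..y} (\<lambda>x. \<bar>g x\<bar>) = V y - V x" if "0 \<le> x" "x \<le> y" "y \<le> 1" for x y
  proof -
    have "V x + integral {x..y} (\<lambda>x. \<bar>g x\<bar>) = V y"
      unfolding V_def using that by (intro Henstock_Kurzweil_Integration.integral_combine)
        (auto intro: integrable_subinterval_real[OF gi(2)])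
    then show ?thesis by simp
  qed
  have rV: "\<bar>r y - r x\<bar> \<le> V y - V x" if "0 \<le> x" "x \<le> y" "y \<le> 1" for x y
    unfolding primitive_diff[OF r that] Vd[OF that, symmetric] real_norm_def[symmetric]
    using that by (intro integral_norm_bound_integral) 
      (auto intro: integrable_subinterval_real[OF gi(1)] integrable_subinterval_real[OF gi(2)])
  have "bounded (D ` {0..1})"
    using D by (intro compact_imp_bounded compact_continuous_image) auto
  then obtain L where L: "\<And>x. x \<in> {0..1} \<Longrightarrow> \<bar>D x\<bar> \<le> L"
    unfolding bounded_iff by (metis image_eqI real_norm_def)
  have L0: "L \<ge> 0" using L[of 0] by simp
  have \<psi>L: "\<bar>\<psi> y - \<psi> x\<bar> \<le> L * \<bar>y - x\<bar>" if "x \<in> {0..1}" "y \<in> {0..1}" for x y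
    using field_differentiable_bound[of "{0..1}" \<psi> D L y x] \<psi> L that by auto
  define k where "k x = g x * \<psi> x + r x * D x" for x
  have k1: "(\<lambda>x. g x * \<psi> x) integrable_on {0..1}"
    using absolutely_integrable_mult_continuous[OF ga \<psi>c] by (simp add: set_lebesgue_integral_eq_integral)
  have k2: "(\<lambda>x. r x * D x) integrable_on {0..1}"
    using rc D by (intro integrable_continuous_interval continuous_intros)
  have ki: "k integrable_on {0..1}"
    unfolding k_def using k1 k2 by (rule integrable_add)
  \<comment> \<open>\<open>H\<close> is the accumulated defect of the product rule, and the claim
    amounts to \<open>H 1 = H 0\<close>.\<close>
  define H where "H x = r x * \<psi> x - integral {0..x} k" for x
  have main: "\<bar>H y - H x\<bar> \<le> 2 * L * (y - x) * (V y - V x)" if xy: "0 \<le> x" "x \<le> y" "y \<le> 1" for x y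
  proof -
    have sub: "f integrable_on {x..y}" if "f integrable_on {0..1}" for f :: "real \<Rightarrow> real"
      using integrable_subinterval_real[OF that] xy by simp
    have kd: "integral {0..x} k + integral {x..y} k = integral {0..y} k"
      using xy by (intro Henstock_Kurzweil_Integration.integral_combine)
        (auto intro: integrable_subinterval_real[OF ki])
    have "(D has_integral (\<psi> y - \<psi> x)) {x..y}"
    proof (rule fundamental_theorem_of_calculus)
      fix t assume "t \<in> {x..y}"
      then have "(\<psi> has_field_derivative D t) (at t within {x..y})"
        using xy by (intro DERIV_subset[OF \<psi>]) auto
      then show "(\<psi> has_vector_derivative D t) (at t within {x..y})"
        by (simp add: has_real_derivative_iff_has_vector_derivative)
    qed (use xy in auto)
    moreover have "(g has_integral (r y - r x)) {x..y}"
      using primitive_diff[OF r xy] sub[OF gi(1)] by (metis integrable_integral)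
    \<comment> \<open>The increment of the product is split with the weights \<open>\<psi> y\<close>
      and \<open>r x\<close>. Subtracting \<open>k\<close> then leaves \<open>g t\<close> multiplied
      by \<open>\<psi> y - \<psi> t\<close>, and \<open>D t\<close> multiplied by
      \<open>r t - r x\<close>; both differences are controlled on \<open>{x..y}\<close>.\<close>
    ultimately have "((\<lambda>t. \<psi> y * g t + r x * D t - k t) has_integral
        (\<psi> y * (r y - r x) + r x * (\<psi> y - \<psi> x) - integral {x..y} k)) {x..y}"
      by (intro has_integral_diff has_integral_add has_integral_mult_right integrable_integral sub[OF ki])
    moreover have "\<psi> y * (r y - r x) + r x * (\<psi> y - \<psi> x) - integral {x..y} k = H y - H x"
      using kd unfolding H_def by (simp add: algebra_simps)
    ultimately have hH: "((\<lambda>t. \<psi> y * g t + r x * D t - k t) has_integral (H y - H x)) {x..y}" by simp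
    have "((\<lambda>t. L * (y - x) * \<bar>g t\<bar> + L * (V y - V x)) has_integral
       (L * (y - x) * (V y - V x) + (y - x) * (L * (V y - V x)))) {x..y}"
    proof (rule has_integral_add)
      have "((\<lambda>t. \<bar>g t\<bar>) has_integral (V y - V x)) {x..y}"
        using Vd[OF xy] sub[OF gi(2)] by (metis integrable_integral)
      then show "((\<lambda>t. L * (y - x) * \<bar>g t\<bar>) has_integral (L * (y - x) * (V y - V x))) {x..y}"
        by (rule has_integral_mult_right)
      show "((\<lambda>t. L * (V y - V x)) has_integral ((y - x) * (L * (V y - V x)))) {x..y}"
        using has_integral_const_real[of "L * (V y - V x)" x y] xy by simp
    qed
    note B = this
    have "norm (integral {x..y} (\<lambda>t. \<psi> y * g t + r x * D t - k t))
        \<le> integral {x..y} (\<lambda>t. L * (y - x) * \<bar>g t\<bar> + L * (V y - V x))"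
    proof (rule integral_norm_bound_integral)
      fix t assume t: "t \<in> {x..y}"
      have a: "\<bar>\<psi> y - \<psi> t\<bar> \<le> L * (y - x)"
        using \<psi>L[of t y] t xy L0 mult_left_mono[of "y - t" "y - x" L] by auto
      have b: "\<bar>r t - r x\<bar> \<le> V y - V x"
        using rV[of x t] rV[of t y] t xy by auto
      have c: "\<bar>D t\<bar> \<le> L" using L t xy by auto
      have "\<psi> y * g t + r x * D t - k t = (\<psi> y - \<psi> t) * g t - D t * (r t - r x)"
        unfolding k_def by (simp add: algebra_simps)
      also have "\<bar>\<dots>\<bar> \<le> \<bar>(\<psi> y - \<psi> t) * g t\<bar> + \<bar>D t * (r t - r x)\<bar>" by (rule abs_triangle_ineq4)
      also have "\<dots> \<le> L * (y - x) * \<bar>g t\<bar> + L * (V y - V x)"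
        unfolding abs_mult using a b c L0 by (intro add_mono mult_mono) auto
      finally show "norm (\<psi> y * g t + r x * D t - k t) \<le> L * (y - x) * \<bar>g t\<bar> + L * (V y - V x)" by simp
    qed (use hH B in \<open>auto simp: integrable_on_def\<close>)
    then have "\<bar>H y - H x\<bar> \<le> L * (y - x) * (V y - V x) + (y - x) * (L * (V y - V x))"
      unfolding integral_unique[OF hH] integral_unique[OF B] by simp
    then show ?thesis by (simp add: algebra_simps)
  qed
  have main': "\<bar>H y - H x\<bar> \<le> 2 * L * \<bar>y - x\<bar> * \<bar>V y - V x\<bar>" if "x \<in> {0..1}" "y \<in> {0..1}" for x y
  proof (cases "x \<le> y")
    case True
    then show ?thesis using main[of x y] rV[of x y] that by auto
  next
    case False
    then show ?thesis using main[of y x] rV[of y x] that by (auto simp: abs_minus_commute)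
  qed
  have "(H has_field_derivative 0) (at x within {0..1})" if x: "x \<in> {0..1}" for x
    unfolding has_field_derivative_iff
  proof (rule Lim_null_comparison)
    have "((\<lambda>y. V y - V x) \<longlongrightarrow> 0) (at x within {0..1})"
      using Vc x unfolding continuous_on_def by (metis LIM_zero)
    then show "((\<lambda>y. 2 * L * \<bar>V y - V x\<bar>) \<longlongrightarrow> 0) (at x within {0..1})"
      by (intro tendsto_mult_right_zero tendsto_rabs_zero)
    show "\<forall>\<^sub>F y in at x within {0..1}. norm ((H y - H x) / (y - x)) \<le> 2 * L * \<bar>V y - V x\<bar>"
      unfolding eventually_at_filter
    proof (intro always_eventually allI impI)
      fix y assume y: "y \<noteq> x" "y \<in> {0..1}"
      have "\<bar>H y - H x\<bar> / \<bar>y - x\<bar> \<le> 2 * L * \<bar>V y - V x\<bar>"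
        using main'[OF x y(2)] y(1) by (subst pos_divide_le_eq) (auto simp: mult_ac)
      then show "norm ((H y - H x) / (y - x)) \<le> 2 * L * \<bar>V y - V x\<bar>"
        by (simp add: abs_divide)
    qed
  qed
  then obtain c where "\<And>x. x \<in> {0..1} \<Longrightarrow> H x = c"
    using has_field_derivative_zero_constant[of "{0..1}" H] by auto
  then have "H 1 = H 0" by auto
  then have "r 1 * \<psi> 1 - r 0 * \<psi> 0 = integral {0..1} k" by (simp add: H_def)
  also have "\<dots> = integral {0..1} (\<lambda>x. g x * \<psi> x) + integral {0..1} (\<lambda>x. r x * D x)"
    unfolding k_def by (rule Henstock_Kurzweil_Integration.integral_add[OF k1 k2])
  finally show ?thesis by simp
qed

lemma set_lebesgue_integral_Ioo_eq_integral:
  fixes f :: "real \<Rightarrow> real"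
  assumes "f absolutely_integrable_on {a..b}"
  shows "(LINT x:{a<..<b}|lebesgue. f x) = integral {a..b} f"
  using assms set_lebesgue_integral_eq_integral(2)[of "{a<..<b}" f]
  by (simp add: absolutely_integrable_on_Icc_iff_Ioo integral_open_interval_real)

lemma test_functionE:
  assumes "test_function \<psi>"
  obtains D where "\<And>x. (\<psi> has_field_derivative D x) (at x)" "continuous_on UNIV D"
    "deriv \<psi> = D" "\<psi> 0 = 0" "\<psi> 1 = 0"
proof -
  obtain D where D: "\<And>x. (\<psi> has_field_derivative D x) (at x)" "continuous_on UNIV D"
    using assms unfolding test_function_def C1_differentiable_on_def
    by (auto simp: has_real_derivative_iff_has_vector_derivative)
  have "\<psi> x = 0" if "x \<notin> {0<..<1}" for x
    using assms that closure_subset[of "{x. \<psi> x \<noteq> 0}"] unfolding test_function_def by blast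
  then show ?thesis
    using that[of D] D DERIV_imp_deriv by (metis ext greaterThanLessThan_iff less_irrefl)
qed

text \<open>Integration by parts, in which the boundary terms vanish because a test function is zero
  at 0 and 1.\<close>

lemma primitive_imp_has_weak_derivative:
  assumes "primitive r g"
  shows "has_weak_derivative r g"
  unfolding has_weak_derivative_def
proof (intro conjI allI impI)
  have g: "g absolutely_integrable_on {0..1}" using assms by (simp add: primitive_def)
  then show "set_integrable lebesgue {0<..<1} g" by (simp add: absolutely_integrable_on_Icc_iff_Ioo)
  fix \<psi> assume "test_function \<psi>"
  then obtain D where D: "\<And>x. (\<psi> has_field_derivative D x) (at x)" "continuous_on UNIV D"
    "deriv \<psi> = D" "\<psi> 0 = 0" "\<psi> 1 = 0" by (rule test_functionE) blast
  have Dc: "continuous_on {0..1} D" using D(2) continuous_on_subset by blast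
  have "continuous_on {0..1} \<psi>"
    using D(1) DERIV_continuous_on has_field_derivative_at_within by blast
  then have 1: "(\<lambda>x. g x * \<psi> x) absolutely_integrable_on {0..1}"
    by (rule absolutely_integrable_mult_continuous[OF g])
  have 2: "(\<lambda>x. r x * D x) absolutely_integrable_on {0..1}"
    by (intro absolutely_integrable_continuous_real continuous_intros primitive_continuous_on[OF assms] Dc)
  have "integral {0..1} (\<lambda>x. r x * D x) + integral {0..1} (\<lambda>x. g x * \<psi> x) = r 1 * \<psi> 1 - r 0 * \<psi> 0"
    by (rule primitive_integration_by_parts[OF assms _ Dc]) (rule has_field_derivative_at_within[OF D(1)])
  then show "(LINT x:{0<..<1}|lebesgue. r x * deriv \<psi> x) = - (LINT x:{0<..<1}|lebesgue. g x * \<psi> x)"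
    unfolding D(3) using D(4,5) by (simp add: set_lebesgue_integral_Ioo_eq_integral 1 2)
qed

section \<open>Explicit test functions built from truncated powers\<close>

text \<open>The second difference with step \<open>d\<close>, divided by \<open>d\<^sup>2\<close>,
  of half the truncated square. For \<open>d > 0\<close> it is a C^1 step that is 0 up to 0 and 1
  from \<open>2 * d\<close> on, so test functions arise without mollifiers.\<close>

definition smooth_step :: "real \<Rightarrow> real \<Rightarrow> real" where
  "smooth_step d x = ((max 0 x)\<^sup>2 - 2 * (max 0 (x - d))\<^sup>2 + (max 0 (x - 2 * d))\<^sup>2) / (2 * d\<^sup>2)"

text \<open>For \<open>d > 0\<close>, the hat function on \<open>{0..2 * d}\<close> with peak
  \<open>1 / d\<close> and integral 1: the derivative of \<open>smooth_step d\<close>, and an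
  approximate identity as \<open>d\<close> tends to 0.\<close>

definition tent :: "real \<Rightarrow> real \<Rightarrow> real" where
  "tent d x = (max 0 x - 2 * max 0 (x - d) + max 0 (x - 2 * d)) / d\<^sup>2"

lemma has_field_derivative_max_0_square:
  "((\<lambda>x::real. (max 0 x)\<^sup>2) has_field_derivative 2 * max 0 x) (at x)"
proof (cases x "0 :: real" rule: linorder_cases)
  case less
  have "((\<lambda>x::real. 0) has_field_derivative 2 * max 0 x) (at x)"
    using less by simp
  then show ?thesis
    by (rule has_field_derivative_transform_within_open[of _ _ _ "{..<0}"]) (use less in auto)
next
  case greater
  have "((\<lambda>x::real. x\<^sup>2) has_field_derivative 2 * max 0 x) (at x)"
    using greater by (auto intro!: derivative_eq_intros)
  then show ?thesis
    by (rule has_field_derivative_transform_within_open[of _ _ _ "{0<..}"]) (use greater in auto)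
next
  case equal
  have "((\<lambda>h::real. (max 0 h)\<^sup>2 / h) \<longlongrightarrow> 0) (at 0)"
  proof (rule Lim_null_comparison)
    show "\<forall>\<^sub>F h in at 0. norm ((max 0 h)\<^sup>2 / h) \<le> \<bar>h :: real\<bar>"
      by (intro always_eventually allI) (auto simp: max_def power2_eq_square)
    show "((\<lambda>h::real. \<bar>h\<bar>) \<longlongrightarrow> 0) (at 0)"
      by (intro tendsto_rabs_zero tendsto_ident_at)
  qed
  then show ?thesis using equal by (simp add: DERIV_def)
qed

lemma smooth_step_has_field_derivative:
  "d > 0 \<Longrightarrow> (smooth_step d has_field_derivative tent d x) (at x)"
proof -
  have shift: "((\<lambda>x. (max 0 (x - c))\<^sup>2) has_field_derivative 2 * max 0 (x - c)) (at x)" for c :: real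
    using DERIV_shift[of "\<lambda>x. (max 0 x)\<^sup>2" _ x "-c"] has_field_derivative_max_0_square[of "x - c"] by simp
  assume "d > 0"
  have "(smooth_step d has_field_derivative
      (2 * max 0 x - 2 * (2 * max 0 (x - d)) + 2 * max 0 (x - 2 * d)) / (2 * d\<^sup>2)) (at x)"
    unfolding smooth_step_def [abs_def]
    by (intro DERIV_cdivide DERIV_add DERIV_diff DERIV_cmult shift has_field_derivative_max_0_square)
  moreover have "(2 * max 0 x - 2 * (2 * max 0 (x - d)) + 2 * max 0 (x - 2 * d)) / (2 * d\<^sup>2) = tent d x"
    using \<open>d > 0\<close> by (simp add: tent_def field_simps)
  ultimately show ?thesis by simp
qed

lemma tent_nonneg: "d > 0 \<Longrightarrow> tent d x \<ge> 0"
  unfolding tent_def by (intro divide_nonneg_nonneg) (auto simp: max_def)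

lemma tent_eq_0: "d > 0 \<Longrightarrow> x \<notin> {0..2 * d} \<Longrightarrow> tent d x = 0"
  unfolding tent_def by (auto simp: max_def)

lemma continuous_on_tent: "continuous_on S (\<lambda>x. tent d (f x))" if "continuous_on S f"
  unfolding tent_def divide_inverse by (intro continuous_intros that)

lemma smooth_step_eq_0: "x \<le> 0 \<Longrightarrow> d > 0 \<Longrightarrow> smooth_step d x = 0"
  by (simp add: smooth_step_def)

lemma smooth_step_eq_1: "d > 0 \<Longrightarrow> x \<ge> 2 * d \<Longrightarrow> smooth_step d x = 1"
  by (simp add: smooth_step_def field_simps power2_eq_square)

text \<open>To the left of both jumps the steps are 0, and to the right of both they are 1. They
  cancel there, which confines the support to \<open>{min a b..max a b + 2 * d}\<close>, inside the
  open unit interval.\<close>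

lemma test_function_smooth_step_diff:
  assumes "d > 0" "0 < a" "0 < b" "a + 2 * d < 1" "b + 2 * d < 1"
  shows "test_function (\<lambda>x. smooth_step d (x - a) - smooth_step d (x - b))" (is "test_function ?\<psi>")
    and "deriv (\<lambda>x. smooth_step d (x - a) - smooth_step d (x - b)) = (\<lambda>x. tent d (x - a) - tent d (x - b))"
proof -
  have *: "(?\<psi> has_field_derivative tent d (x - a) - tent d (x - b)) (at x)" for x
    using DERIV_shift[of "smooth_step d" _ x "-a"] DERIV_shift[of "smooth_step d" _ x "-b"]
      smooth_step_has_field_derivative[OF assms(1)]
    by (auto intro!: DERIV_diff)
  then show "deriv ?\<psi> = (\<lambda>x. tent d (x - a) - tent d (x - b))"
    by (intro ext DERIV_imp_deriv)
  have sub: "{x. ?\<psi> x \<noteq> 0} \<subseteq> {min a b..max a b + 2 * d}"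
  proof safe
    fix x assume nz: "?\<psi> x \<noteq> 0"
    have "?\<psi> x = 0" if "x < min a b"
      using that assms by (simp add: smooth_step_eq_0)
    moreover have "?\<psi> x = 0" if "x > max a b + 2 * d"
      using that assms by (simp add: smooth_step_eq_1)
    ultimately show "x \<in> {min a b..max a b + 2 * d}" using nz by force
  qed
  then have cl: "closure {x. ?\<psi> x \<noteq> 0} \<subseteq> {min a b..max a b + 2 * d}"
    by (intro closure_minimal) auto
  have "compact (closure {x. ?\<psi> x \<noteq> 0})"
    using sub bounded_subset[OF bounded_closed_interval] by (simp add: compact_closure) 
  moreover have "closure {x. ?\<psi> x \<noteq> 0} \<subseteq> {0<..<1}"
    using cl assms by (rule_tac order_trans[OF cl]) auto
  moreover have "?\<psi> C1_differentiable_on UNIV"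
    unfolding C1_differentiable_on_def
    using * by (intro exI[of _ "\<lambda>x. tent d (x - a) - tent d (x - b)"])
      (auto simp: has_real_derivative_iff_has_vector_derivative intro!: continuous_intros continuous_on_tent)
  ultimately show "test_function ?\<psi>" by (simp add: test_function_def)
qed

lemma integral_tent:
  assumes "d > 0" "0 \<le> a" "a + 2 * d \<le> 1"
  shows "((\<lambda>x. tent d (x - a)) has_integral 1) {0..1}"
proof -
  have "((\<lambda>x. tent d (x - a)) has_integral (smooth_step d (1 - a) - smooth_step d (0 - a))) {0..1}"
  proof (rule fundamental_theorem_of_calculus)
    fix x :: real
    have "((\<lambda>x. smooth_step d (x - a)) has_field_derivative tent d (x - a)) (at x)"
      using DERIV_shift[of "smooth_step d" _ x "-a"] smooth_step_has_field_derivative[OF assms(1)] by auto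
    then show "((\<lambda>x. smooth_step d (x - a)) has_vector_derivative tent d (x - a)) (at x within {0..1})"
      by (simp add: has_real_derivative_iff_has_vector_derivative has_vector_derivative_at_within)
  qed simp
  then show ?thesis using assms by (simp add: smooth_step_eq_0 smooth_step_eq_1)
qed

text \<open>The shifted tent is a probability density on \<open>{a..a + 2 * d}\<close>, so the
  weighted mean of \<open>w\<close> deviates from \<open>w a\<close> by at most the oscillation
  there.\<close>

lemma integral_mult_tent_approx:
  assumes w: "continuous_on {0..1} w" and d: "d > 0" "0 \<le> a" "a + 2 * d \<le> 1"
    and e: "\<And>x. x \<in> {a..a + 2 * d} \<Longrightarrow> \<bar>w x - w a\<bar> \<le> e"
  shows "\<bar>integral {0..1} (\<lambda>x. w x * tent d (x - a)) - w a\<bar> \<le> e"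
proof -
  have I: "(\<lambda>x. w x * tent d (x - a)) integrable_on {0..1}"
    by (intro integrable_continuous_interval continuous_intros continuous_on_tent w)
  have W: "((\<lambda>x. w x * tent d (x - a) - w a * tent d (x - a)) has_integral
      (integral {0..1} (\<lambda>x. w x * tent d (x - a)) - w a * 1)) {0..1}"
    by (intro has_integral_diff has_integral_mult_right integral_tent d integrable_integral I)
  have E: "((\<lambda>x. e * tent d (x - a)) has_integral e * 1) {0..1}"
    by (intro has_integral_mult_right integral_tent d)
  have "norm (integral {0..1} (\<lambda>x. w x * tent d (x - a) - w a * tent d (x - a)))
      \<le> integral {0..1} (\<lambda>x. e * tent d (x - a))"
  proof (rule integral_norm_bound_integral)
    fix x :: real
    show "norm (w x * tent d (x - a) - w a * tent d (x - a)) \<le> e * tent d (x - a)"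
    proof (cases "x \<in> {a..a + 2 * d}")
      case True
      have "w x * tent d (x - a) - w a * tent d (x - a) = (w x - w a) * tent d (x - a)"
        by (simp add: algebra_simps)
      then show ?thesis
        using mult_right_mono[OF e[OF True] tent_nonneg[OF d(1), of "x - a"]] tent_nonneg[OF d(1), of "x - a"]
        by (simp add: abs_mult)
    next
      case False
      then have "tent d (x - a) = 0" using d by (intro tent_eq_0) auto
      then show ?thesis by simp
    qed
  qed (use W E in \<open>auto simp: integrable_on_def\<close>)
  then show ?thesis unfolding integral_unique[OF W] integral_unique[OF E] by simp
qed

text \<open>Du Bois-Reymond: testing against the difference of two smoothed steps compares \<open>w\<close> at the two
  jump points.\<close>

lemma constant_of_test_integrals:
  assumes w: "continuous_on {0..1} w"
    and test: "\<And>\<psi>. test_function \<psi> \<Longrightarrow> integral {0..1} (\<lambda>x. w x * deriv \<psi> x) = 0"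
    and x: "x \<in> {0..1}"
  shows "w x = w 0"
proof -
  \<comment> \<open>A whole range of widths \<open>d\<close> is provided, so that one
    \<open>d\<close> can serve two points at once.\<close>
  have near: "\<exists>D>0. \<forall>d. 0 < d \<and> d < D \<longrightarrow> a + 2 * d < 1 \<and>
      \<bar>integral {0..1} (\<lambda>x. w x * tent d (x - a)) - w a\<bar> \<le> e" if a: "a \<in> {0<..<1}" and e: "e > 0" for a e
  proof -
    obtain \<delta> where \<delta>: "\<delta> > 0" "\<And>x. x \<in> {0..1} \<Longrightarrow> dist x a < \<delta> \<Longrightarrow> dist (w x) (w a) < e"
      using w a e unfolding continuous_on_iff by (metis greaterThanLessThan_iff atLeastAtMost_iff less_imp_le)
    show ?thesis
    proof (intro exI[of _ "min (\<delta> / 2) ((1 - a) / 2)"] conjI allI impI)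
      show "min (\<delta> / 2) ((1 - a) / 2) > 0" using \<delta>(1) a by auto
      fix d assume d: "0 < d \<and> d < min (\<delta> / 2) ((1 - a) / 2)"
      show "a + 2 * d < 1" using d by auto
      show "\<bar>integral {0..1} (\<lambda>x. w x * tent d (x - a)) - w a\<bar> \<le> e"
      proof (rule integral_mult_tent_approx[OF w])
        fix x assume "x \<in> {a..a + 2 * d}"
        then have "dist (w x) (w a) < e" using d a by (intro \<delta>(2)) (auto simp: dist_real_def)
        then show "\<bar>w x - w a\<bar> \<le> e" by (simp add: dist_real_def)
      qed (use d a in auto)
    qed
  qed
  have eq: "w a = w b" if a: "a \<in> {0<..<1}" and b: "b \<in> {0<..<1}" for a b
  proof (rule ccontr)
    assume ne: "w a \<noteq> w b"
    \<comment> \<open>A third of the gap: the two tent averages coincide and each is within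
      \<open>e\<close> of its point value, so a gap of \<open>3 * e\<close> would be at most
      \<open>2 * e\<close>.\<close>
    define e where "e = \<bar>w a - w b\<bar> / 3"
    have e: "e > 0" using ne by (simp add: e_def)
    obtain D1 where D1: "D1 > 0" "\<And>d. 0 < d \<and> d < D1 \<Longrightarrow> a + 2 * d < 1 \<and>
      \<bar>integral {0..1} (\<lambda>x. w x * tent d (x - a)) - w a\<bar> \<le> e" using near[OF a e] by blast
    obtain D2 where D2: "D2 > 0" "\<And>d. 0 < d \<and> d < D2 \<Longrightarrow> b + 2 * d < 1 \<and>
      \<bar>integral {0..1} (\<lambda>x. w x * tent d (x - b)) - w b\<bar> \<le> e" using near[OF b e] by blast
    define d where "d = min D1 D2 / 2"
    have d: "0 < d" "d < D1" "d < D2" using D1(1) D2(1) by (auto simp: d_def)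
    note 1 = D1(2)[of d] and 2 = D2(2)[of d]
    have "0 = integral {0..1} (\<lambda>x. w x * (tent d (x - a) - tent d (x - b)))"
      using test[OF test_function_smooth_step_diff(1)[of d a b]] test_function_smooth_step_diff(2)[of d a b]
        1 2 d a b by simp
    also have "\<dots> = integral {0..1} (\<lambda>x. w x * tent d (x - a) - w x * tent d (x - b))"
      by (simp add: right_diff_distrib)
    also have "\<dots> = integral {0..1} (\<lambda>x. w x * tent d (x - a)) - integral {0..1} (\<lambda>x. w x * tent d (x - b))"
      by (intro Henstock_Kurzweil_Integration.integral_diff integrable_continuous_interval
          continuous_intros continuous_on_tent w)
    finally have "\<bar>w a - w b\<bar> \<le> 2 * e" using 1 2 d by linarith
    then show False using e unfolding e_def by simp
  qed
  \<comment> \<open>Test functions reach only interior points; the endpoints follow by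
    continuity.\<close>
  have "w y = w (1/2)" if "y \<in> {0..1}" for y
  proof (rule continuous_constant_on_closure[of "{0<..<1}" w "w (1/2)" y])
    show "continuous_on (closure {0<..<1::real}) w" using w by simp
    show "w x = w (1 / 2)" if "x \<in> {0<..<1}" for x using eq[of x "1/2"] that by simp
  qed (use that in simp)
  from this[OF x] this[of 0] show ?thesis by simp
qed

section \<open>Equivalence of weak derivatives and primitives\<close>

text \<open>The indefinite integral \<open>G\<close> has the same weak derivative \<open>g\<close>.
  Hence \<open>r - G\<close> integrates to zero against the derivative of every test function and is
  constant.\<close>

lemma has_weak_derivative_imp_primitive:
  assumes r: "continuous_on {0..1} r" and g: "has_weak_derivative r g"
  shows "primitive r g"
proof -
  have ga: "g absolutely_integrable_on {0..1}"
    using g by (simp add: has_weak_derivative_def absolutely_integrable_on_Icc_iff_Ioo)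
  define G where "G x = integral {0..x} g" for x
  have G: "primitive G g" unfolding primitive_def using ga by (auto simp: G_def)
  have const: "r x - G x = r 0 - G 0" if x: "x \<in> {0..1}" for x
  proof (rule constant_of_test_integrals[OF _ _ x])
    show "continuous_on {0..1} (\<lambda>x. r x - G x)"
      by (intro continuous_intros r primitive_continuous_on[OF G])
    fix \<psi> assume \<psi>: "test_function \<psi>"
    then obtain D where D: "\<And>x. (\<psi> has_field_derivative D x) (at x)" "continuous_on UNIV D"
      "deriv \<psi> = D" "\<psi> 0 = 0" "\<psi> 1 = 0" by (rule test_functionE) blast
    have Dc: "continuous_on {0..1} D" using D(2) continuous_on_subset by blast
    have 1: "(\<lambda>x. r x * D x) absolutely_integrable_on {0..1}"
      by (intro absolutely_integrable_continuous_real continuous_intros r Dc)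
    have 2: "(\<lambda>x. G x * D x) absolutely_integrable_on {0..1}"
      by (intro absolutely_integrable_continuous_real continuous_intros primitive_continuous_on[OF G] Dc)
    have "(LINT x:{0<..<1}|lebesgue. q x * deriv \<psi> x) = - (LINT x:{0<..<1}|lebesgue. g x * \<psi> x)"
      if "has_weak_derivative q g" for q
      using that \<psi> unfolding has_weak_derivative_def by blast
    from this[OF g] this[OF primitive_imp_has_weak_derivative[OF G]]
    have "(LINT x:{0<..<1}|lebesgue. r x * deriv \<psi> x) = (LINT x:{0<..<1}|lebesgue. G x * deriv \<psi> x)"
      by (rule trans[OF _ sym])
    then have "integral {0..1} (\<lambda>x. r x * D x) = integral {0..1} (\<lambda>x. G x * D x)"
      unfolding D(3) by (simp add: set_lebesgue_integral_Ioo_eq_integral 1 2)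
    then have "integral {0..1} (\<lambda>x. r x * D x - G x * D x) = 0"
      using 1 2 by (subst Henstock_Kurzweil_Integration.integral_diff)
        (auto simp: set_lebesgue_integral_eq_integral)
    then show "integral {0..1} (\<lambda>x. (r x - G x) * deriv \<psi> x) = 0"
      unfolding D(3) by (simp add: left_diff_distrib)
  qed
  have "r x = r 0 + integral {0..x} g" if "x \<in> {0..1}" for x
    using const[OF that, unfolded G_def] by (simp del: atLeastAtMost_iff)
  then show ?thesis using ga unfolding primitive_def by blast
qed

text \<open>Both densities have the same indefinite integral, so
  \<open>negligible_nonzero_of_vanishing_integrals\<close> applies to their difference.\<close>

lemma primitive_unique:
  assumes "primitive r g" "primitive r g'"
  shows "negligible {x \<in> {0..1}. g x \<noteq> g' x}"
proof -
  have gi: "g integrable_on {0..1}" "g' integrable_on {0..1}"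
    using assms by (simp_all add: primitive_integrable)
  have "negligible {x \<in> {0..1}. g x - g' x \<noteq> 0}"
  proof (rule negligible_nonzero_of_vanishing_integrals)
    show "(\<lambda>x. g x - g' x) integrable_on {0..1}" using gi by (rule integrable_diff)
    fix x :: real assume x: "x \<in> {0..1}"
    have "integral {0..x} g = integral {0..x} g'"
      using primitive_eq[OF assms(1) x] primitive_eq[OF assms(2) x] by linarith
    then show "integral {0..x} (\<lambda>x. g x - g' x) = 0"
      using x by (subst Henstock_Kurzweil_Integration.integral_diff)
        (auto intro: integrable_subinterval_real[OF gi(1)] integrable_subinterval_real[OF gi(2)])
  qed
  then show ?thesis by simp
qed

lemma primitive_imp_W11:
  assumes "primitive r g"
  shows "r \<in> W11"
proof -
  have "r absolutely_integrable_on {0..1}"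
    by (intro absolutely_integrable_continuous_real primitive_continuous_on[OF assms])
  then show ?thesis
    using primitive_imp_has_weak_derivative[OF assms]
    unfolding W11_def by (auto simp: absolutely_integrable_on_Icc_iff_Ioo)
qed

lemma W11_primitive_weak_deriv:
  assumes "r \<in> W11" "continuous_on {0..1} r"
  shows "primitive r (weak_deriv r)"
proof -
  have "has_weak_derivative r (weak_deriv r)"
    using assms(1) someI_ex[of "has_weak_derivative r"] unfolding W11_def weak_deriv_def by blast
  then show ?thesis using assms(2) by (rule has_weak_derivative_imp_primitive[rotated])
qed

text \<open>\<open>weak_deriv\<close> is an arbitrary choice; this allows any explicit density to
  replace it in a.e. statements and under integrals.\<close>

lemma weak_deriv_eq_ae:
  assumes "primitive r g"
  shows "negligible {x \<in> {0..1}. weak_deriv r x \<noteq> g x}"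
  using primitive_unique W11_primitive_weak_deriv primitive_imp_W11 primitive_continuous_on assms by blast

section \<open>Strict positivity, rescaling and gluing of integrals\<close>

text \<open>If the integral were not positive, all integrals from \<open>a\<close> would vanish and
  \<open>f\<close> would be zero almost everywhere, yet a nonempty open interval is not negligible.
  An argument of this kind suits integrands that contain a merely measurable density.\<close>

lemma integral_pos:
  fixes f :: "real \<Rightarrow> real"
  assumes f: "f integrable_on {a..b}" and ab: "a < b"
    and nn: "\<And>x. x \<in> {a..b} \<Longrightarrow> f x \<ge> 0" and pos: "\<And>x. x \<in> {a<..<b} \<Longrightarrow> f x > 0"
  shows "integral {a..b} f > 0"
proof (rule ccontr)
  assume "\<not> integral {a..b} f > 0"
  moreover have sub: "f integrable_on {u..v}" if "a \<le> u" "v \<le> b" for u v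
    using integrable_subinterval_real[OF f] that by simp
  have nonneg: "integral {u..v} f \<ge> 0" if "a \<le> u" "v \<le> b" for u v
    by (rule Henstock_Kurzweil_Integration.integral_nonneg[OF sub]) (use that nn in auto)
  ultimately have zero: "integral {a..b} f \<le> 0" by simp
  have "integral {a..x} f = 0" if "x \<in> {a..b}" for x
  proof -
    have "integral {a..x} f + integral {x..b} f = integral {a..b} f"
      using that by (intro Henstock_Kurzweil_Integration.integral_combine f) auto
    then show ?thesis using zero nonneg[of a x] nonneg[of x b] that by simp
  qed
  then have "negligible {x \<in> {a..b}. f x \<noteq> 0}"
    by (rule negligible_nonzero_of_vanishing_integrals[OF f])
  then have "negligible {a<..<b}"
    by (rule negligible_subset) (auto dest: pos)
  then show False using open_not_negligible[of "{a<..<b}"] ab by auto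
qed

lemma integral_rescale:
  fixes f :: "real \<Rightarrow> real"
  assumes c: "c > 0" and f: "f absolutely_integrable_on {0..c * x}"
  shows "(\<lambda>t. f (c * t)) absolutely_integrable_on {0..x}"
    and "integral {0..x} (\<lambda>t. f (c * t)) = integral {0..c * x} f / c"
proof -
  \<comment> \<open>Extension by zero turns the integral into one over the line, where the affine
    substitution is available; scaling carries the cut-off \<open>{0..c * x}\<close> to
    \<open>{0..x}\<close>.\<close>
  define k where "k t = indicat_real {0..c * x} t *\<^sub>R f t" for t
  have k: "k (c * t) = indicat_real {0..x} t *\<^sub>R f (c * t)" for t
    using c by (auto simp: k_def indicator_def zero_le_mult_iff)
  have ki: "integrable lebesgue k" using f unfolding set_integrable_def k_def .
  show *: "(\<lambda>t. f (c * t)) absolutely_integrable_on {0..x}"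
    using lebesgue_integrable_real_affine[OF ki, of c 0] c
    unfolding set_integrable_def k[symmetric] by simp
  have "integral\<^sup>L lebesgue k = c * integral\<^sup>L lebesgue (\<lambda>t. k (c * t))"
    using lebesgue_integral_real_affine[of c k 0] c by simp
  then show "integral {0..x} (\<lambda>t. f (c * t)) = integral {0..c * x} f / c"
    using c set_lebesgue_integral_eq_integral(2)[OF *] set_lebesgue_integral_eq_integral(2)[OF f]
    unfolding set_lebesgue_integral_def k[symmetric] k_def[symmetric] by simp
qed

lemma integral_if_le:
  fixes f h :: "real \<Rightarrow> real"
  assumes f: "f absolutely_integrable_on {a..c}" and h: "h absolutely_integrable_on {c..b}"
    and c: "a \<le> c" "c \<le> b"
  shows "(\<lambda>x. if x \<le> c then f x else h x) absolutely_integrable_on {a..b}" (is "?k absolutely_integrable_on _")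
    and "integral {a..b} (\<lambda>x. if x \<le> c then f x else h x) = integral {a..c} f + integral {c..b} h"
proof -
  have 1: "?k absolutely_integrable_on {a..c}"
    by (rule absolutely_integrable_spike[OF f negligible_empty]) auto
  \<comment> \<open>The value at \<open>c\<close> belongs to \<open>f\<close>, so agreement with
    \<open>h\<close> can fail at this one point.\<close>
  have 2: "?k absolutely_integrable_on {c..b}"
    by (rule absolutely_integrable_spike[OF h negligible_sing[of c]]) auto
  show 3: "?k absolutely_integrable_on {a..b}"
    by (rule absolutely_integrable_on_combine[OF 1 2 c])
  have "integral {a..b} ?k = integral {a..c} ?k + integral {c..b} ?k"
    by (rule Henstock_Kurzweil_Integration.integral_combine[symmetric, OF c])
      (rule set_lebesgue_integral_eq_integral(1)[OF 3])
  also have "integral {a..c} ?k = integral {a..c} f"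
    by (rule integral_spike[OF negligible_empty]) auto
  also have "integral {c..b} ?k = integral {c..b} h"
    by (rule integral_spike[OF negligible_sing[of c]]) auto
  finally show "integral {a..b} ?k = integral {a..c} f + integral {c..b} h" .
qed

lemma primitive_linear: "primitive (\<lambda>x. l * x) (\<lambda>_. l)"
  unfolding primitive_def by (auto simp: absolutely_integrable_continuous_real)

text \<open>The factor \<open>1 / c\<close> outside cancels the \<open>c\<close> of the chain rule,
  so the derivative is that of \<open>r\<close> evaluated at \<open>c * x\<close>. The quotient of
  the map by its argument behaves in the same way.\<close>

lemma primitive_rescale:
  assumes r: "primitive r g" and c: "0 < c" "c \<le> 1"
  shows "primitive (\<lambda>x. r (c * x) / c) (\<lambda>x. g (c * x))"
  unfolding primitive_def
proof (intro conjI ballI)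
  have ga: "g absolutely_integrable_on {0..1}" using r by (simp add: primitive_def)
  have g: "g absolutely_integrable_on {0..c * x}" if "x \<in> {0..1}" for x
    using absolutely_integrable_on_subinterval[OF ga, of 0 "c * x"] mult_le_one[of c x] c that by auto
  show "(\<lambda>x. g (c * x)) absolutely_integrable_on {0..1}"
    using integral_rescale(1)[OF c(1) g[of 1]] by simp
  fix x :: real assume x: "x \<in> {0..1}"
  have cx: "c * x \<in> {0..1}" using c x mult_le_one[of c x] by auto
  show "r (c * x) / c = r (c * 0) / c + integral {0..x} (\<lambda>x. g (c * x))"
    unfolding integral_rescale(2)[OF c(1) g[OF x]] primitive_eq[OF r cx]
    by (simp add: add_divide_distrib)
qed

text \<open>The matching condition \<open>r c = l * c\<close> excludes a jump at \<open>c\<close>,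
  so the increments of both pieces add up.\<close>

lemma primitive_glue_linear:
  assumes r: "primitive r g" and c: "0 \<le> c" "c \<le> 1" and rc: "r c = l * c"
  shows "primitive (\<lambda>x. if x \<le> c then l * x else r x) (\<lambda>x. if x \<le> c then l else g x)" (is "primitive ?r ?g")
  unfolding primitive_def
proof (intro conjI ballI)
  have ga: "g absolutely_integrable_on {0..1}" using r by (simp add: primitive_def)
  have g: "g absolutely_integrable_on {c..x}" if "x \<in> {0..1}" for x
    using absolutely_integrable_on_subinterval[OF ga, of c x] c that by auto
  have l: "(\<lambda>_. l) absolutely_integrable_on {0..c}"
    by (simp add: absolutely_integrable_continuous_real)
  show "?g absolutely_integrable_on {0..1}"
    by (rule integral_if_le(1)[OF l g c]) simp
  fix x :: real assume x: "x \<in> {0..1}"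
  show "?r x = ?r 0 + integral {0..x} ?g"
  proof (cases "x \<le> c")
    case True
    have "integral {0..x} ?g = integral {0..x} (\<lambda>_. l)"
      by (rule integral_spike[OF negligible_empty]) (use True in auto)
    then show ?thesis using True x c by simp
  next
    case False
    then show ?thesis
      using integral_if_le(2)[OF l g[OF x] c(1)] primitive_diff[OF r c(1), of x] x c rc by (simp add: mult.commute)
  qed
qed

section \<open>Energies of glued and rescaled maps\<close>

lemma mec_density_spike:
  assumes "primitive r g"
  obtains N where "negligible N"
    "\<And>R. R \<in> {0..1} - N \<Longrightarrow> mec_density \<Phi> r R * R\<^sup>2 = \<Phi> (g R) (r R / R) (r R / R) * R\<^sup>2"
  using that[OF weak_deriv_eq_ae[OF assms]] by (simp add: mec_density_def)

lemma mec_density_integrable_iff: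
  assumes "primitive r g"
  shows "set_integrable lebesgue {0<..<1} (\<lambda>R. mec_density \<Phi> r R * R\<^sup>2) \<longleftrightarrow>
    (\<lambda>R. \<Phi> (g R) (r R / R) (r R / R) * R\<^sup>2) absolutely_integrable_on {0..1}"
proof -
  obtain N where N: "negligible N"
    "\<And>R. R \<in> {0..1} - N \<Longrightarrow> mec_density \<Phi> r R * R\<^sup>2 = \<Phi> (g R) (r R / R) (r R / R) * R\<^sup>2"
    using mec_density_spike[OF assms] by blast
  show ?thesis
    unfolding absolutely_integrable_on_Icc_iff_Ioo[symmetric]
    by (rule absolutely_integrable_spike_eq[OF N(1) N(2)[symmetric]])
qed

lemma I_mec_eq:
  assumes "primitive r g"
    and "(\<lambda>R. \<Phi> (g R) (r R / R) (r R / R) * R\<^sup>2) absolutely_integrable_on {0..1}"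
  shows "I_mec \<Phi> r = integral {0..1} (\<lambda>R. \<Phi> (g R) (r R / R) (r R / R) * R\<^sup>2)"
proof -
  obtain N where N: "negligible N"
    "\<And>R. R \<in> {0..1} - N \<Longrightarrow> mec_density \<Phi> r R * R\<^sup>2 = \<Phi> (g R) (r R / R) (r R / R) * R\<^sup>2"
    using mec_density_spike[OF assms(1)] by blast
  have "I_mec \<Phi> r = integral {0..1} (\<lambda>R. mec_density \<Phi> r R * R\<^sup>2)"
    unfolding I_mec_def using assms(2) mec_density_integrable_iff[OF assms(1)]
    by (intro set_lebesgue_integral_Ioo_eq_integral) (simp add: absolutely_integrable_on_Icc_iff_Ioo)
  also have "\<dots> = integral {0..1} (\<lambda>R. \<Phi> (g R) (r R / R) (r R / R) * R\<^sup>2)"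
    by (rule integral_spike[OF N(1)]) (simp add: N(2))
  finally show ?thesis .
qed

lemma I_grav_eq:
  assumes r: "primitive r g"
    and F: "(\<lambda>R. \<Phi> (g R) (r R / R) (r R / R) * R\<^sup>2) absolutely_integrable_on {0..1}"
    and W: "(\<lambda>R. \<rho> R * (mass_within \<rho> R / r R) * R\<^sup>2) absolutely_integrable_on {0..1}"
  shows "I_grav \<Phi> \<rho> r = integral {0..1} (\<lambda>R. \<Phi> (g R) (r R / R) (r R / R) * R\<^sup>2)
    - integral {0..1} (\<lambda>R. \<rho> R * (mass_within \<rho> R / r R) * R\<^sup>2)"
proof -
  have M: "set_integrable lebesgue {0<..<1} (\<lambda>R. mec_density \<Phi> r R * R\<^sup>2)"
    using F mec_density_integrable_iff[OF r] by simp
  have W': "set_integrable lebesgue {0<..<1} (\<lambda>R. \<rho> R * (mass_within \<rho> R / r R) * R\<^sup>2)"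
    using W by (simp add: absolutely_integrable_on_Icc_iff_Ioo)
  have "I_grav \<Phi> \<rho> r = I_mec \<Phi> r - (LINT R:{0<..<1}|lebesgue. \<rho> R * (mass_within \<rho> R / r R) * R\<^sup>2)"
    unfolding I_grav_def I_mec_def left_diff_distrib by (rule set_integral_diff(2)[OF M W'])
  then show ?thesis
    unfolding I_mec_eq[where \<Phi> = \<Phi>, OF r F] set_lebesgue_integral_Ioo_eq_integral[OF W] .
qed

section \<open>Admissibility expressed through a primitive\<close>

lemma ae_Ioo_iff_negligible:
  "(AE x \<in> {a<..<b::real} in lebesgue. P x) \<longleftrightarrow> negligible {x \<in> {a<..<b}. \<not> P x}"
  unfolding eventually_ae_filter_negligible
  by (auto intro: negligible_subset intro!: exI[of _ "{x \<in> {a<..<b}. \<not> P x}"])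

text \<open>A primitive is continuous and lies in \<open>W11\<close>. In the remaining conditions
  \<open>weak_deriv r\<close> may be exchanged for \<open>g\<close>, since the two differ on a
  negligible set only.\<close>

lemma admissible_iff:
  assumes "primitive r g"
  shows "r \<in> admissible \<Phi> l \<longleftrightarrow> r 1 = l \<and> r 0 \<ge> 0 \<and> negligible {x \<in> {0<..<1}. \<not> g x > 0} \<and>
    (\<lambda>R. \<Phi> (g R) (r R / R) (r R / R) * R\<^sup>2) absolutely_integrable_on {0..1}"
proof -
  have n: "negligible {x \<in> {0..1}. weak_deriv r x \<noteq> g x}" by (rule weak_deriv_eq_ae[OF assms])
  have "negligible {x \<in> {0<..<1}. \<not> weak_deriv r x > 0} \<longleftrightarrow> negligible {x \<in> {0<..<1}. \<not> g x > 0}"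
    (is "negligible ?A \<longleftrightarrow> negligible ?B")
  proof
    assume "negligible ?A"
    from negligible_Un[OF this n] show "negligible ?B" by (rule negligible_subset) auto
  next
    assume "negligible ?B"
    from negligible_Un[OF this n] show "negligible ?A" by (rule negligible_subset) auto
  qed
  then show ?thesis
    using primitive_imp_W11[OF assms] primitive_continuous_on[OF assms]
      mec_density_integrable_iff[OF assms, of \<Phi>]
    unfolding admissible_def ae_Ioo_iff_negligible by auto
qed

lemma admissible_primitive: "r \<in> admissible \<Phi> l \<Longrightarrow> primitive r (weak_deriv r)"
  by (rule W11_primitive_weak_deriv) (auto simp: admissible_def)

lemma negligible_rescale:
  fixes c :: real
  assumes "c > 0" "negligible S"
  shows "negligible {x. c * x \<in> S}"
proof -
  have "negligible ((\<lambda>x. x / c) ` S)"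
    by (rule negligible_differentiable_image_negligible[OF _ assms(2)])
      (use assms(1) in \<open>auto simp: divide_inverse intro!: derivative_intros\<close>)
  moreover have "{x. c * x \<in> S} \<subseteq> (\<lambda>x. x / c) ` S"
    using assms(1) by (auto intro!: image_eqI[where x = "c * _"])
  ultimately show ?thesis by (rule negligible_subset)
qed

section \<open>The mass function, monotonicity and the first crossing\<close>

lemma continuous_on_mass_within:
  assumes "\<rho> absolutely_integrable_on {0..1}"
  shows "continuous_on {0..1} (mass_within \<rho>)"
proof -
  have *: "(\<lambda>u. \<rho> u * u\<^sup>2) absolutely_integrable_on {0..1}"
    by (intro absolutely_integrable_mult_continuous assms continuous_intros)
  have "continuous_on {0..1} (\<lambda>R. 4 * pi * integral {0..R} (\<lambda>u. \<rho> u * u\<^sup>2))"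
    by (intro continuous_intros indefinite_integral_continuous_1 set_lebesgue_integral_eq_integral(1)[OF *])
  then show ?thesis
  proof (rule continuous_on_eq)
    fix R :: real assume "R \<in> {0..1}"
    then have "(\<lambda>u. \<rho> u * u\<^sup>2) absolutely_integrable_on {0..R}"
      by (intro absolutely_integrable_on_subinterval[OF *]) auto
    then show "4 * pi * integral {0..R} (\<lambda>u. \<rho> u * u\<^sup>2) = mass_within \<rho> R"
      by (simp add: mass_within_def set_lebesgue_integral_eq_integral(2))
  qed
qed

lemma mass_within_pos:
  assumes "\<rho> absolutely_integrable_on {0..1}" and pos: "\<And>x. x \<in> {0..1} \<Longrightarrow> \<rho> x > 0"
    and R: "0 < R" "R \<le> 1"
  shows "mass_within \<rho> R > 0"
proof -
  have *: "(\<lambda>u. \<rho> u * u\<^sup>2) absolutely_integrable_on {0..1}"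
    by (intro absolutely_integrable_mult_continuous assms(1) continuous_intros)
  have **: "(\<lambda>u. \<rho> u * u\<^sup>2) absolutely_integrable_on {0..R}"
    by (rule absolutely_integrable_on_subinterval[OF *]) (use R in auto)
  have "integral {0..R} (\<lambda>u. \<rho> u * u\<^sup>2) > 0"
    using pos R by (intro integral_pos set_lebesgue_integral_eq_integral(1)[OF **])
      (auto intro!: mult_nonneg_nonneg mult_pos_pos simp: less_imp_le)
  then show ?thesis by (simp add: mass_within_def set_lebesgue_integral_eq_integral(2)[OF **])
qed

text \<open>An a.e. positive density cannot lower the primitive. When \<open>r 0 > 0\<close>, this
  keeps \<open>r\<close> away from zero, so that division by \<open>r\<close> is harmless.\<close>

lemma primitive_ge_initial:
  assumes r: "primitive r g" and g: "negligible {x \<in> {0<..<1}. \<not> g x > 0}" and x: "x \<in> {0..1}"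
  shows "r x \<ge> r 0"
proof -
  have gi: "g integrable_on {0..x}"
    using x by (intro integrable_subinterval_real[OF primitive_integrable[OF r]]) auto
  have n: "negligible ({x \<in> {0<..<1}. \<not> g x > 0} \<union> {0, 1})" (is "negligible ?N")
    by (intro negligible_Un g) simp
  \<comment> \<open>On a null set, or at 0 and 1, \<open>g\<close> may be negative; truncation
    restores the sign everywhere without changing the integral.\<close>
  have eq: "max 0 (g t) = g t" if "t \<in> {0..x} - ?N" for t
    using that x by force
  have "0 \<le> integral {0..x} (\<lambda>t. max 0 (g t))"
    by (intro Henstock_Kurzweil_Integration.integral_nonneg integrable_spike[OF gi n] eq) auto
  also have "\<dots> = integral {0..x} g" by (rule integral_spike[OF n]) (simp add: eq)
  finally show ?thesis using primitive_eq[OF r x] by linarith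
qed

text \<open>The set where \<open>f\<close> is at most 0 is compact and nonempty, and
  \<open>c\<close> is its least element.\<close>

lemma first_crossing:
  fixes f :: "real \<Rightarrow> real"
  assumes f: "continuous_on {0..1} f" and "f 0 > 0" "f 1 < 0"
  obtains c where "0 < c" "c < 1" "f c = 0" "\<And>x. 0 \<le> x \<Longrightarrow> x < c \<Longrightarrow> f x > 0"
proof -
  define S where "S = {x \<in> {0..1}. f x \<le> 0}"
  have "S = {0..1} \<inter> f -` {..0}" by (auto simp: S_def)
  moreover have "closed ({0..1} \<inter> f -` {..0})"
    by (rule continuous_closed_preimage[OF f]) auto
  moreover have "bounded S" unfolding S_def by (rule bounded_subset[OF bounded_closed_interval[of 0 1]]) auto
  ultimately have "compact S" by (simp add: compact_eq_bounded_closed)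
  moreover have "S \<noteq> {}" using assms(3) by (auto simp: S_def intro!: exI[of _ 1])
  ultimately obtain c where c: "c \<in> S" "\<And>x. x \<in> S \<Longrightarrow> c \<le> x" using compact_attains_inf by metis
  have c01: "0 \<le> c" "c \<le> 1" "f c \<le> 0" using c(1) by (auto simp: S_def)
  have below: "f x > 0" if "0 \<le> x" "x < c" for x
    using c(2)[of x] that c01 by (force simp: S_def)
  \<comment> \<open>The intermediate value theorem gives a zero in \<open>{0..c}\<close>; minimality
    of \<open>c\<close> forces it to be \<open>c\<close> itself.\<close>
  obtain x where x: "0 \<le> x" "x \<le> c" "f x = 0"
    using IVT2'[of f c 0 0] c01 assms(2) continuous_on_subset[OF f, of "{0..c}"] by auto
  then have "f c = 0" using below[of x] by (cases "x = c") auto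
  moreover from this have "c \<noteq> 0" "c \<noteq> 1" using assms(2,3) by auto
  ultimately show ?thesis using that[of c] c01 below by simp
qed

section \<open>Comparison of a cavitating minimizer with the glued map\<close>

theorem theorem5p1:
  fixes \<Phi> :: "real \<Rightarrow> real \<Rightarrow> real \<Rightarrow> real"
    and \<phi> h \<rho>0 r :: "real \<Rightarrow> real"
    and k0 k1 C \<gamma> K s lam lamc :: real
  assumes Phi_nonneg: "\<And>v1 v2 v3. v1 > 0 \<Longrightarrow> v2 > 0 \<Longrightarrow> v3 > 0 \<Longrightarrow> \<Phi> v1 v2 v3 \<ge> 0"
    and Phi_symmetric: "\<And>v1 v2 v3. v1 > 0 \<Longrightarrow> v2 > 0 \<Longrightarrow> v3 > 0 \<Longrightarrow>
          \<Phi> v1 v2 v3 = \<Phi> v2 v1 v3 \<and> \<Phi> v1 v2 v3 = \<Phi> v1 v3 v2"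
    and Phi_bound: "\<And>v1 v2 v3. v1 > 0 \<Longrightarrow> v2 > 0 \<Longrightarrow> v3 > 0 \<Longrightarrow>
          \<Phi> v1 v2 v3 \<ge> \<phi> v1 + \<phi> v2 + \<phi> v3 + h (v1 * v2 * v3)"
    and phi_pos: "\<And>v. v > 0 \<Longrightarrow> \<phi> v > 0"
    and h_pos: "\<And>d. d > 0 \<Longrightarrow> h d > 0"
    and phi_convex: "strictly_convex_on {0<..} \<phi>"
    and h_convex: "strictly_convex_on {0<..} h"
    and C_pos: "C > 0" and gamma: "1 < \<gamma>" "\<gamma> < 3"
    and phi_growth: "\<And>v. v > 0 \<Longrightarrow> \<phi> v \<ge> C * v powr \<gamma>"
    and h_superlinear: "filterlim (\<lambda>d. h d / d) at_top at_top"
    and K_pos: "K > 0" and s: "s \<ge> \<gamma> / (\<gamma> - 1)"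
    and h_growth: "\<And>d. d > 0 \<Longrightarrow> h d \<ge> K * d powr (- s)"
    and k_pos: "k0 > 0" "k1 > 0"
    and rho_measurable: "set_borel_measurable lebesgue {0..1} \<rho>0"
    and rho_bounds: "\<And>R. 0 \<le> R \<Longrightarrow> R \<le> 1 \<Longrightarrow> k0 \<le> \<rho>0 R \<and> \<rho>0 R \<le> k1"
    and critical: "critical_displacement \<Phi> lamc"
    and lambda_pos: "lam > 0"
    and r_min: "minimizer (I_grav \<Phi> \<rho>0) (admissible \<Phi> lam) r"
    and lambda_less: "lam < lamc"
  shows "r 0 = 0"
proof (rule ccontr)
  assume r0: "r 0 \<noteq> 0"
  define g where "g = weak_deriv r"
  have adm: "r \<in> admissible \<Phi> lam" using r_min by (simp add: minimizer_def is_arg_min_def)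
  then have r: "primitive r g" unfolding g_def by (rule admissible_primitive)
  define F where "F R = \<Phi> (g R) (r R / R) (r R / R) * R\<^sup>2" for R
  have r1: "r 1 = lam" and "r 0 \<ge> 0" and g: "negligible {x \<in> {0<..<1}. \<not> g x > 0}"
    and F: "F absolutely_integrable_on {0..1}"
    using adm admissible_iff[OF r] by (auto simp: F_def[abs_def])
  then have r0: "r 0 > 0" using r0 by simp
  have rpos: "r x > 0" if "x \<in> {0..1}" for x
    using primitive_ge_initial[OF r g that] r0 by simp
  have lamc: "lamc > 0" using critical by (simp add: critical_displacement_def)
  have rc: "continuous_on {0..1} r" by (rule primitive_continuous_on[OF r])
  have "continuous_on {0..1} (\<lambda>x. r x - lamc * x)" by (intro continuous_intros rc)
  then obtain c where c: "0 < c" "c < 1" "r c - lamc * c = 0"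
    and above: "\<And>x. 0 \<le> x \<Longrightarrow> x < c \<Longrightarrow> r x - lamc * x > 0"
  proof (rule first_crossing)
    show "r 0 - lamc * 0 > 0" "r 1 - lamc * 1 < 0" using r0 r1 lambda_less by simp_all
  qed blast
  have rho: "\<rho>0 absolutely_integrable_on {0..1}"
  proof (rule set_integrable_bound[OF _ rho_measurable])
    show "(\<lambda>_. k1) absolutely_integrable_on {0..1::real}"
      by (rule absolutely_integrable_continuous_real) (rule continuous_on_const)
    show "AE x in lebesgue. x \<in> {0..1} \<longrightarrow> norm (\<rho>0 x) \<le> norm k1"
      using rho_bounds k_pos by (intro AE_I2) force
  qed
  have rho_pos: "\<rho>0 x > 0" if "x \<in> {0..1}" for x
    using rho_bounds[of x] k_pos that by auto
  define m where "m = mass_within \<rho>0"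
  have mc: "continuous_on {0..1} m" unfolding m_def by (rule continuous_on_mass_within[OF rho])
  have mpos: "m x > 0" if "0 < x" "x \<le> 1" for x
    unfolding m_def by (rule mass_within_pos[OF rho rho_pos that])

  define A where "A R = \<Phi> lamc lamc lamc * R\<^sup>2" for R
  have A: "A absolutely_integrable_on {0..x}" for x
    unfolding A_def by (intro absolutely_integrable_continuous_real continuous_intros)
  have F_sub: "F absolutely_integrable_on {a..b}" if "0 \<le> a" "b \<le> 1" for a b
    by (rule absolutely_integrable_on_subinterval[OF F]) (use that in auto)

  have mech: "integral {0..c} A \<le> integral {0..c} F"
  proof -
    \<comment> \<open>The part of \<open>r\<close> on \<open>{0..c}\<close> blown up to the unit
      interval; \<open>q 1 = r c / c = lamc\<close> makes the critical displacement the right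
      one.\<close>
    define q where "q x = r (c * x) / c" for x
    have q: "primitive q (\<lambda>x. g (c * x))"
      unfolding q_def using primitive_rescale[OF r c(1)] c by simp
    have Fq: "\<Phi> (g (c * R)) (q R / R) (q R / R) * R\<^sup>2 = F (c * R) / c\<^sup>2" for R
      using c by (simp add: F_def q_def power_mult_distrib)
    \<comment> \<open>At \<open>R = 0\<close> the quotient \<open>lamc * R / R\<close> is 0 instead
      of \<open>lamc\<close>, but the factor \<open>R\<^sup>2\<close> makes both sides zero.\<close>
    have Al: "\<Phi> lamc (lamc * R / R) (lamc * R / R) * R\<^sup>2 = A (c * R) / c\<^sup>2" for R
      using c by (cases "R = 0") (auto simp: A_def power_mult_distrib)
    note Fi = integral_rescale[where f = F and x = 1, OF c(1)] and Ai = integral_rescale[where f = A and x = 1, OF c(1) A]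
    have Fqi: "(\<lambda>R. F (c * R) / c\<^sup>2) absolutely_integrable_on {0..1}"
      using Fi(1) F_sub c by (intro set_integrable_divide) auto
    have Ali: "(\<lambda>R. A (c * R) / c\<^sup>2) absolutely_integrable_on {0..1}"
      using Ai(1) c by (intro set_integrable_divide) auto
    have "negligible {x \<in> {0<..<1}. \<not> g (c * x) > 0}"
      by (rule negligible_subset[OF negligible_rescale[OF c(1) g]])
        (use c mult_strict_mono[of c 1 _ 1] in auto)
    then have "q \<in> admissible \<Phi> lamc"
      unfolding admissible_iff[OF q] Fq using Fqi c r0 by (auto simp: q_def divide_simps)
    \<comment> \<open>The critical value itself belongs to the range in which the homogeneous map is
      optimal.\<close>
    moreover have "minimizer (I_mec \<Phi>) (admissible \<Phi> lamc) (\<lambda>R. lamc * R)"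
      using critical lamc unfolding critical_displacement_def by blast
    ultimately have "I_mec \<Phi> (\<lambda>R. lamc * R) \<le> I_mec \<Phi> q"
      unfolding minimizer_def is_arg_min_def by force
    then have "integral {0..1} (\<lambda>R. A (c * R) / c\<^sup>2) \<le> integral {0..1} (\<lambda>R. F (c * R) / c\<^sup>2)"
      using I_mec_eq[OF primitive_linear, of \<Phi> lamc] I_mec_eq[OF q, of \<Phi>] Ali Fqi
      unfolding Fq Al by simp
    \<comment> \<open>Returning to the variable \<open>c * R\<close> produces the factor
      \<open>1 / c ^ 3\<close> on both sides, which cancels.\<close>
    then show ?thesis
      using Ai(2) Fi(2) F_sub c by (simp add: divide_le_cancel)
  qed

  \<comment> \<open>\<open>W\<close> and \<open>B\<close> enter the energy with a minus sign, so a
    larger integral means a lower energy.\<close>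
  define W where "W R = \<rho>0 R * (m R / r R) * R\<^sup>2" for R
  define B where "B R = \<rho>0 R * (m R / (lamc * R)) * R\<^sup>2" for R
  have W: "W absolutely_integrable_on {0..1}"
  proof -
    have "(\<lambda>R. \<rho>0 R * (m R / r R * R\<^sup>2)) absolutely_integrable_on {0..1}"
      using rpos by (intro absolutely_integrable_mult_continuous rho continuous_intros mc rc) force
    then show ?thesis unfolding W_def by (simp add: mult.assoc)
  qed
  have B: "B absolutely_integrable_on {0..1}"
  proof -
    have "(\<lambda>R. \<rho>0 R * (m R * R / lamc)) absolutely_integrable_on {0..1}"
      using lamc by (intro absolutely_integrable_mult_continuous rho continuous_intros mc) auto
    \<comment> \<open>One factor \<open>R\<close> cancels, which removes the apparent singularity at
      0.\<close>
    moreover have "B = (\<lambda>R. \<rho>0 R * (m R * R / lamc))"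
      by (auto simp: B_def power2_eq_square)
    ultimately show ?thesis by simp
  qed
  have W_sub: "W absolutely_integrable_on {a..b}" if "0 \<le> a" "b \<le> 1" for a b
    by (rule absolutely_integrable_on_subinterval[OF W]) (use that in auto)
  have B_sub: "B absolutely_integrable_on {0..c}"
    by (rule absolutely_integrable_on_subinterval[OF B]) (use c in auto)
  have grav: "integral {0..c} W < integral {0..c} B"
  proof -
    have less: "W R < B R" if "0 < R" "R < c" for R
    proof -
      have "m R / r R < m R / (lamc * R)"
        using that above[of R] mpos[of R] rpos[of R] lamc c by (intro divide_strict_left_mono) auto
      then show ?thesis
        unfolding W_def B_def using that rho_pos[of R] c
        by (intro mult_strict_right_mono mult_strict_left_mono) auto
    qed
    have "integral {0..c} (\<lambda>R. B R - W R) > 0"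
    proof (rule integral_pos)
      show "(\<lambda>R. B R - W R) integrable_on {0..c}"
        using B_sub W_sub[of 0 c] c by (intro integrable_diff) (auto intro: set_lebesgue_integral_eq_integral(1))
      show "B R - W R \<ge> 0" if "R \<in> {0..c}" for R
      proof -
        \<comment> \<open>At 0 both integrands vanish through \<open>R\<^sup>2\<close>, and at
          \<open>c\<close> they agree because \<open>r c = lamc * c\<close>.\<close>
        consider "R = 0" | "0 < R" "R < c" | "R = c" using \<open>R \<in> {0..c}\<close> by force
        then show ?thesis
        proof cases
          case 3
          then show ?thesis using c(3) by (simp add: B_def W_def)
        qed (use less[of R] in \<open>auto simp: B_def W_def\<close>)
      qed
    qed (use less c in auto)
    then show ?thesis
      using B_sub W_sub[of 0 c] c
      by (subst (asm) Henstock_Kurzweil_Integration.integral_diff)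
        (auto intro: set_lebesgue_integral_eq_integral(1))
  qed

  define rt where "rt x = (if x \<le> c then lamc * x else r x)" for x
  define gt where "gt x = (if x \<le> c then lamc else g x)" for x
  have rt: "primitive rt gt"
    unfolding rt_def[abs_def] gt_def[abs_def] using c by (intro primitive_glue_linear r) auto
  have Ft: "(\<lambda>R. \<Phi> (gt R) (rt R / R) (rt R / R) * R\<^sup>2) = (\<lambda>R. if R \<le> c then A R else F R)"
  proof
    fix R show "\<Phi> (gt R) (rt R / R) (rt R / R) * R\<^sup>2 = (if R \<le> c then A R else F R)"
      by (cases "R = 0") (auto simp: A_def F_def rt_def gt_def)
  qed
  have Wt: "(\<lambda>R. \<rho>0 R * (mass_within \<rho>0 R / rt R) * R\<^sup>2) = (\<lambda>R. if R \<le> c then B R else W R)"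
    by (auto simp: B_def W_def rt_def m_def)
  note Fti = integral_if_le[OF A[of c] F_sub[of c 1]] and Wti = integral_if_le[OF B_sub W_sub[of c 1]]
  have "rt \<in> admissible \<Phi> lam"
    unfolding admissible_iff[OF rt] Ft
  proof (intro conjI)
    show "negligible {x \<in> {0<..<1}. \<not> 0 < gt x}"
      by (rule negligible_subset[OF g]) (use lamc in \<open>auto simp: gt_def\<close>)
  qed (use c r1 Fti(1) in \<open>auto simp: rt_def\<close>)
  then have "I_grav \<Phi> \<rho>0 r \<le> I_grav \<Phi> \<rho>0 rt"
    using r_min unfolding minimizer_def is_arg_min_def by force
  also have "I_grav \<Phi> \<rho>0 rt = (integral {0..c} A + integral {c..1} F) - (integral {0..c} B + integral {c..1} W)"
    using I_grav_eq[OF rt, of \<Phi> \<rho>0] Fti Wti c unfolding Ft Wt by simp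
  \<comment> \<open>The contributions from \<open>{c..1}\<close> are common to both maps. On
    \<open>{0..c}\<close> the mechanical comparison is weak, and the strictness comes from gravity
    alone.\<close>
  also have "\<dots> < (integral {0..c} F + integral {c..1} F) - (integral {0..c} W + integral {c..1} W)"
    using mech grav by simp
  also have "\<dots> = integral {0..1} F - integral {0..1} W"
    using F W c by (simp add: Henstock_Kurzweil_Integration.integral_combine set_lebesgue_integral_eq_integral(1))
  also have "\<dots> = I_grav \<Phi> \<rho>0 r"
    using I_grav_eq[OF r, of \<Phi> \<rho>0] F W unfolding F_def W_def m_def by simp
  finally show False by simp
qed

end
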